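(* Let $\mathbb{K}\in\{\mathbb{R},\mathbb{C}\}$, let $M\in \mathrm{GL}_3(\mathbb{K}^* )$ be non-singular (in the non-standard sense that the determinant of an appreciable representative of $M$ is appreciable), and let $p,p'$ be points of $\mathbb{K}^*\mathbb{P}^2$ that are almost equivalent. Then the images $[M_{\mathbb{A}}p_{\mathbb{A}}]$ and $[M_{\mathbb{A}}p'_{\mathbb{A}}]$ of $p$ and $p'$ under the projective transformation given by $M$ are also almost equivalent.
   Context: $\mathbb{R}^*$ and $\mathbb{C}^*$ are the hyperreal and hypercomplex numbers of non-standard analysis ($\mathbb{C}^*=\mathbb{R}^*+i\,\mathbb{R}^*$). A number $r$ is appreciable if $1/n<|r|<n$ for some $n\in\mathbb{N}$; $\mathbb{A}$ is the set of appreciable numbers; a number is limited if it is infinitesimal or appreciable. For numbers, $a\simeq b$ means $a-b$ is infinitesimal; for vectors this is meant componentwise. $\mathbb{K}^*\mathbb{P}^2=((\mathbb{K}^* )^3\setminus\{0\})/(\mathbb{K}^*\setminus\{0\})$. $\|\cdot\|$ is the Euclidean norm on vectors and the Frobenius norm on matrices. For nonzero $r$, $\mathbf{mag}(r)=\{s\neq 0 : \exists A\in\mathbb{A},\ r=A s\}$. An appreciable representative of a point $x$ is a vector $x_{\mathbb{A}}=\lambda^{-1}x$ with $\lambda\in\mathbf{mag}(\|x\|)$ (all components are limited, at least one is appreciable). An appreciable representative of a nonzero matrix $M$ is $M_{\mathbb{A}}=\lambda^{-1}M$ with $\lambda\in\mathbf{mag}(\|M\|)$. $M$ is non-singular if $\det(M_{\mathbb{A}})$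 is appreciable. The (appreciable) projective transformation given by $M$ sends a point $p$ to $M_{\mathbb{A}}p_{\mathbb{A}}$. Two points $x,y$ are almost equivalent, written $x\simeq y$, if there is $\lambda\in\mathbb{K}^*$ with $x_{\mathbb{A}}\simeq\lambda\, y_{\mathbb{A}}$ for appreciable representatives $x_{\mathbb{A}},y_{\mathbb{A}}$. *)

theory Defs
  imports "HOL-Analysis.Analysis"
begin

section \<open>Ultrapowers along a free ultrafilter on the natural numbers\<close>

text \<open>A filter below \<^term>\<open>sequentially\<close> contains all cofinite sets, i.e. it is free.\<close>

definition free_ultrafilter :: "nat filter \<Rightarrow> bool" where
  "free_ultrafilter U \<longleftrightarrow>
     U \<noteq> bot \<and> U \<le> sequentially \<and> (\<forall>P. eventually P U \<or> eventually (\<lambda>n. \<not> P n) U)"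

lemma free_ultrafilter_exists: "\<exists>U. free_ultrafilter U"
proof -
  define S where "S = {F :: nat filter. F \<noteq> bot \<and> F \<le> sequentially}"
  have "\<exists>m\<in>S. \<forall>a\<in>S. m \<ge> a \<longrightarrow> a = m"
  proof (rule predicate_Zorn)
    show "partial_order_on S (relation_of (\<lambda>x y. y \<le> x) S)"
      by (rule partial_order_on_relation_ofI) auto
  next
    fix C assume C: "C \<in> Chains (relation_of (\<lambda>x y. y \<le> x) S)"
    show "\<exists>u\<in>S. \<forall>a\<in>C. u \<le> a"
    proof (cases "C = {}")
      case True
      then show ?thesis by (auto simp: S_def intro!: exI[of _ sequentially])
    next
      case False
      have CS: "C \<subseteq> S" and ch: "\<And>a b. a \<in> C \<Longrightarrow> b \<in> C \<Longrightarrow> a \<le> b \<or> b \<le> a"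
        using C by (auto simp: Chains_def relation_of_def)
      have "eventually P (Inf C) \<longleftrightarrow> (\<exists>b\<in>C. eventually P b)" for P
        by (rule eventually_Inf_base[OF False]) (metis ch inf.absorb1 inf.absorb2 order_refl)
      then have "Inf C \<noteq> bot"
        using CS by (auto simp: trivial_limit_def S_def)
      moreover have "Inf C \<le> sequentially"
        using False CS by (auto simp: S_def intro: Inf_lower2)
      ultimately show ?thesis
        by (auto simp: S_def intro!: bexI[of _ "Inf C"] Inf_lower)
    qed
  qed
  then obtain U where U: "U \<noteq> bot" "U \<le> sequentially"
    and min: "\<And>F. F \<noteq> bot \<Longrightarrow> F \<le> U \<Longrightarrow> F = U"
    by (auto simp: S_def intro: order_trans)
  have "eventually P U \<or> eventually (\<lambda>n. \<not> P n) U" for P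
  proof (cases "inf U (principal {n. P n}) = bot")
    case True
    then show ?thesis by (auto simp: trivial_limit_def eventually_inf_principal)
  next
    case False
    then have "inf U (principal {n. P n}) = U" by (rule min) simp
    moreover have "eventually P (inf U (principal {n. P n}))"
      by (simp add: eventually_inf_principal)
    ultimately show ?thesis by simp
  qed
  with U show ?thesis unfolding free_ultrafilter_def by blast
qed

definition hyper_filter :: "nat filter" where
  "hyper_filter = (SOME U. free_ultrafilter U)"

lemma free_ultrafilter_hyper_filter: "free_ultrafilter hyper_filter"
  unfolding hyper_filter_def using free_ultrafilter_exists by (rule someI_ex)

lemma hyper_filter_not_bot [simp]: "hyper_filter \<noteq> bot"
  using free_ultrafilter_hyper_filter by (simp add: free_ultrafilter_def)

lemma eventually_hyper_not_iff:
  "eventually (\<lambda>n. \<not> P n) hyper_filter \<longleftrightarrow> \<not> eventually P hyper_filter"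
proof
  assume "eventually (\<lambda>n. \<not> P n) hyper_filter"
  then show "\<not> eventually P hyper_filter"
    using eventually_conj[of P hyper_filter "\<lambda>n. \<not> P n"] by auto
qed (use free_ultrafilter_hyper_filter in \<open>auto simp: free_ultrafilter_def\<close>)

quotient_type 'a hyper = "nat \<Rightarrow> 'a" / "\<lambda>X Y. eventually (\<lambda>n. X n = Y n) hyper_filter"
  morphisms hyper_repr hyper_class
  by (rule equivpI; rule reflpI sympI transpI) (auto elim: eventually_mono eventually_elim2)

instantiation hyper :: (field) field
begin

lift_definition zero_hyper :: "'a hyper" is "\<lambda>n. 0" .
lift_definition one_hyper :: "'a hyper" is "\<lambda>n. 1" .
lift_definition plus_hyper :: "'a hyper \<Rightarrow> 'a hyper \<Rightarrow> 'a hyper" is "\<lambda>X Y n. X n + Y n"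
  by (auto elim: eventually_elim2)
lift_definition minus_hyper :: "'a hyper \<Rightarrow> 'a hyper \<Rightarrow> 'a hyper" is "\<lambda>X Y n. X n - Y n"
  by (auto elim: eventually_elim2)
lift_definition uminus_hyper :: "'a hyper \<Rightarrow> 'a hyper" is "\<lambda>X n. - X n"
  by (auto elim: eventually_mono)
lift_definition times_hyper :: "'a hyper \<Rightarrow> 'a hyper \<Rightarrow> 'a hyper" is "\<lambda>X Y n. X n * Y n"
  by (auto elim: eventually_elim2)
lift_definition inverse_hyper :: "'a hyper \<Rightarrow> 'a hyper" is "\<lambda>X n. inverse (X n)"
  by (auto elim: eventually_mono)
lift_definition divide_hyper :: "'a hyper \<Rightarrow> 'a hyper \<Rightarrow> 'a hyper" is "\<lambda>X Y n. X n / Y n"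
  by (auto elim: eventually_elim2)

instance
proof
  fix a :: "'a hyper"
  show "a \<noteq> 0 \<Longrightarrow> inverse a * a = 1"
    by transfer (auto simp: eventually_hyper_not_iff[symmetric] elim: eventually_mono)
qed (transfer; simp add: algebra_simps divide_inverse eventually_hyper_not_iff)+

end

instantiation hyper :: (linordered_field) linordered_field
begin

lift_definition less_eq_hyper :: "'a hyper \<Rightarrow> 'a hyper \<Rightarrow> bool"
  is "\<lambda>X Y. eventually (\<lambda>n. X n \<le> Y n) hyper_filter"
  by (rule eventually_subst, erule (1) eventually_elim2) simp
lift_definition less_hyper :: "'a hyper \<Rightarrow> 'a hyper \<Rightarrow> bool"
  is "\<lambda>X Y. eventually (\<lambda>n. X n < Y n) hyper_filter"
  by (rule eventually_subst, erule (1) eventually_elim2) simp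
lift_definition abs_hyper :: "'a hyper \<Rightarrow> 'a hyper" is "\<lambda>X n. \<bar>X n\<bar>"
  by (auto elim: eventually_mono)
lift_definition sgn_hyper :: "'a hyper \<Rightarrow> 'a hyper" is "\<lambda>X n. sgn (X n)"
  by (auto elim: eventually_mono)

instance
proof
  fix x y z :: "'a hyper"
  show "x < y \<longleftrightarrow> x \<le> y \<and> \<not> y \<le> x"
    by transfer (auto simp: eventually_hyper_not_iff[symmetric] not_le
        elim: eventually_mono eventually_elim2)
  show "x \<le> x" by transfer simp
  show "x \<le> y \<Longrightarrow> y \<le> z \<Longrightarrow> x \<le> z"
    by transfer (auto elim: eventually_elim2)
  show "x \<le> y \<Longrightarrow> y \<le> x \<Longrightarrow> x = y"
    by transfer (auto elim: eventually_elim2)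
  show "x \<le> y \<or> y \<le> x"
  proof transfer
    fix X Y :: "nat \<Rightarrow> 'a"
    have "eventually (\<lambda>n. Y n \<le> X n) hyper_filter"
      if "\<not> eventually (\<lambda>n. X n \<le> Y n) hyper_filter"
      using that unfolding eventually_hyper_not_iff[symmetric] by (auto elim: eventually_mono)
    then show "eventually (\<lambda>n. X n \<le> Y n) hyper_filter \<or>
        eventually (\<lambda>n. Y n \<le> X n) hyper_filter" by blast
  qed
  show "x \<le> y \<Longrightarrow> z + x \<le> z + y"
    by transfer (auto elim: eventually_mono)
  show "x < y \<Longrightarrow> 0 < z \<Longrightarrow> z * x < z * y"
    by transfer (auto elim: eventually_elim2)
  show "\<bar>x\<bar> = (if x < 0 then - x else x)"
  proof (cases "x < 0")
    case True
    then have "\<bar>x\<bar> = - x" by transfer (auto elim: eventually_mono)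
    with True show ?thesis by simp
  next
    case False
    then have "\<bar>x\<bar> = x"
      by transfer (auto simp: eventually_hyper_not_iff[symmetric] elim: eventually_mono)
    with False show ?thesis by simp
  qed
  show "sgn x = (if x = 0 then 0 else if 0 < x then 1 else - 1)"
  proof -
    have "sgn x = 0" if "x = 0" using that by transfer (auto elim: eventually_mono)
    moreover have "sgn x = 1" if "0 < x" using that by transfer (auto elim: eventually_mono)
    moreover have "sgn x = - 1" if "x \<noteq> 0" "\<not> 0 < x"
      using that
      by transfer (auto simp: eventually_hyper_not_iff[symmetric] sgn_if elim: eventually_elim2)
    ultimately show ?thesis by simp
  qed
qed

end

lift_definition hyper_of_real :: "real hyper \<Rightarrow> 'a::real_normed_field hyper"
  is "\<lambda>X n. of_real (X n)"
  by (auto elim: eventually_mono)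

lift_definition habs :: "'a::real_normed_field hyper \<Rightarrow> real hyper"
  is "\<lambda>X n. norm (X n)"
  by (auto elim: eventually_mono)

lift_definition hsqrt :: "real hyper \<Rightarrow> real hyper" is "\<lambda>X n. sqrt (X n)"
  by (auto elim: eventually_mono)

lemma hyper_of_real_real [simp]: "hyper_of_real (x :: real hyper) = x"
  by transfer simp

lemma habs_real [simp]: "habs (x :: real hyper) = \<bar>x\<bar>"
  by transfer simp

lift_definition hyper_const :: "'a \<Rightarrow> 'a hyper" is "\<lambda>a n. a" .

text \<open>
  The type \<^typ>\<open>complex hyper\<close> is the field of hypercomplex numbers: it is spanned over the
  hyperreals by 1 and the imaginary unit.
\<close>

lemma hypercomplex_ex:
  "\<exists>a b. (z :: complex hyper) = hyper_of_real a + hyper_const \<i> * hyper_of_real b"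
proof transfer
  fix Z :: "nat \<Rightarrow> complex"
  show "\<exists>A B. eventually (\<lambda>n. Z n = of_real (A n) + \<i> * of_real (B n)) hyper_filter"
    by (rule exI[of _ "\<lambda>n. Re (Z n)"], rule exI[of _ "\<lambda>n. Im (Z n)"]) (simp add: complex_eq)
qed

lemma hypercomplex_unique:
  "hyper_of_real a + hyper_const \<i> * hyper_of_real b =
     (hyper_of_real a' + hyper_const \<i> * hyper_of_real b' :: complex hyper) \<Longrightarrow>
   a = a' \<and> b = b'"
  by transfer (auto simp: complex_eq_iff elim: eventually_mono)


section \<open>Orders of magnitude\<close>

definition infinitesimal :: "'a::real_normed_field hyper \<Rightarrow> bool" where
  "infinitesimal r \<longleftrightarrow> (\<forall>n::nat. n > 0 \<longrightarrow> habs r < 1 / of_nat n)"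

definition appreciable :: "'a::real_normed_field hyper \<Rightarrow> bool" where
  "appreciable r \<longleftrightarrow> (\<exists>n::nat. n > 0 \<and> 1 / of_nat n < habs r \<and> habs r < of_nat n)"

definition mag :: "'a::real_normed_field hyper \<Rightarrow> 'a hyper set" where
  "mag r = {s. s \<noteq> 0 \<and> (\<exists>A. appreciable A \<and> r = A * s)}"

definition vec_approx :: "'a::real_normed_field hyper^'n \<Rightarrow> 'a hyper^'n \<Rightarrow> bool" where
  "vec_approx x y \<longleftrightarrow> (\<forall>i. infinitesimal (x $ i - y $ i))"

definition hnorm_vec :: "'a::real_normed_field hyper^'n \<Rightarrow> real hyper" where
  "hnorm_vec x = hsqrt (\<Sum>i\<in>UNIV. (habs (x $ i))\<^sup>2)"

definition hnorm_mat :: "'a::real_normed_field hyper^'n^'m \<Rightarrow> real hyper" where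
  "hnorm_mat M = hsqrt (\<Sum>i\<in>UNIV. \<Sum>j\<in>UNIV. (habs (M $ i $ j))\<^sup>2)"


section \<open>The projective plane\<close>

definition proportional :: "'a::field hyper^3 \<Rightarrow> 'a hyper^3 \<Rightarrow> bool" where
  "proportional x y \<longleftrightarrow> x \<noteq> 0 \<and> y \<noteq> 0 \<and> (\<exists>c. c \<noteq> 0 \<and> x = c *s y)"

lemma proportional_refl: "x \<noteq> 0 \<Longrightarrow> proportional x x"
  unfolding proportional_def by (metis vector_smult_lid zero_neq_one)

lemma proportional_sym: "proportional x y \<Longrightarrow> proportional y x"
proof -
  assume "proportional x y"
  then obtain c where c: "x \<noteq> 0" "y \<noteq> 0" "c \<noteq> 0" "x = c *s y"
    by (auto simp: proportional_def)
  have "y = inverse c *s x"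
    unfolding c(4) using c(3) by (simp add: vector_smult_assoc)
  moreover have "inverse c \<noteq> 0" using c(3) by simp
  ultimately show ?thesis unfolding proportional_def using c(1,2) by blast
qed

lemma proportional_trans: "proportional x y \<Longrightarrow> proportional y z \<Longrightarrow> proportional x z"
  unfolding proportional_def by (metis mult_eq_0_iff vector_smult_assoc)

quotient_type (overloaded) 'a hproj2 = "'a::field hyper^3" / partial: proportional
proof (rule part_equivpI)
  have "axis 1 1 \<noteq> (0 :: 'a hyper^3)" by (simp add: axis_eq_0_iff)
  then show "\<exists>x :: 'a hyper^3. proportional x x" using proportional_refl by blast
qed (blast intro: sympI transpI proportional_sym proportional_trans)+

text \<open>
  \<open>hpoint x\<close> is the class of \<open>x\<close>.  It is meaningful for nonzero \<open>x\<close> only; its value at the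
  zero vector is an unspecified point.
\<close>

definition hpoint :: "'a::field hyper^3 \<Rightarrow> 'a hproj2" where
  "hpoint x = abs_hproj2 x"

lemma hpoint_eq_iff:
  "x \<noteq> 0 \<Longrightarrow> y \<noteq> 0 \<Longrightarrow> hpoint x = hpoint y \<longleftrightarrow> (\<exists>c. c \<noteq> 0 \<and> x = c *s y)"
proof -
  assume xy: "x \<noteq> 0" "y \<noteq> 0"
  then have "proportional x x" "proportional y y"
    by (simp_all add: proportional_refl)
  then have "hpoint x = hpoint y \<longleftrightarrow> proportional x y"
    using Quotient3_rel[OF Quotient3_hproj2, of x y] by (simp add: hpoint_def)
  with xy show ?thesis by (simp add: proportional_def)
qed

lemma hpoint_surj: "\<exists>x. x \<noteq> 0 \<and> p = hpoint x"
proof -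
  have "proportional (rep_hproj2 p) (rep_hproj2 p)"
    by (rule Quotient3_rep_reflp[OF Quotient3_hproj2])
  moreover have "p = hpoint (rep_hproj2 p)"
    unfolding hpoint_def by (rule Quotient3_abs_rep[OF Quotient3_hproj2, symmetric])
  ultimately show ?thesis unfolding proportional_def by blast
qed


section \<open>Appreciable representatives\<close>

text \<open>
  The scale \<open>l\<close> ranges over all numbers of the base field of the right magnitude; the norm, a
  hyperreal, is therefore read as an element of that field.
\<close>

definition appreciable_rep :: "'a::real_normed_field hproj2 \<Rightarrow> 'a hyper^3 \<Rightarrow> bool" where
  "appreciable_rep p v \<longleftrightarrow>
     (\<exists>x l. x \<noteq> 0 \<and> p = hpoint x \<and> l \<in> mag (hyper_of_real (hnorm_vec x)) \<and> v = inverse l *s x)"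

definition appreciable_rep_mat ::
    "'a::real_normed_field hyper^3^3 \<Rightarrow> 'a hyper^3^3 \<Rightarrow> bool" where
  "appreciable_rep_mat M N \<longleftrightarrow>
     M \<noteq> 0 \<and>
     (\<exists>l. l \<in> mag (hyper_of_real (hnorm_mat M)) \<and> N = (\<chi> i j. inverse l * M $ i $ j))"

lemma hsqrt_eq_0_iff [simp]: "hsqrt x = 0 \<longleftrightarrow> x = 0"
  by transfer simp

lemma habs_eq_0_iff [simp]: "habs x = 0 \<longleftrightarrow> x = 0"
  by transfer simp

lemma hyper_of_real_eq_0_iff [simp]: "hyper_of_real x = 0 \<longleftrightarrow> x = 0"
  by transfer simp

lemma hnorm_vec_eq_0_iff [simp]: "hnorm_vec x = 0 \<longleftrightarrow> x = 0"
  by (simp add: hnorm_vec_def sum_nonneg_eq_0_iff vec_eq_iff)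

lemma hnorm_mat_eq_0_iff [simp]: "hnorm_mat M = 0 \<longleftrightarrow> M = 0"
  by (simp add: hnorm_mat_def sum_nonneg_eq_0_iff sum_nonneg vec_eq_iff)

lemma self_in_mag: "r \<noteq> 0 \<Longrightarrow> r \<in> mag r"
proof -
  have "habs (1 :: 'a hyper) = 1" by transfer simp
  then have "appreciable (1 :: 'a hyper)"
    by (auto simp: appreciable_def intro!: exI[of _ 2])
  then show "r \<noteq> 0 \<Longrightarrow> r \<in> mag r" by (auto simp: mag_def intro!: exI[of _ 1])
qed

lemma appreciable_rep_exists: "\<exists>v. appreciable_rep p v"
proof -
  obtain x where "x \<noteq> 0" "p = hpoint x" using hpoint_surj by blast
  then show ?thesis
    unfolding appreciable_rep_def using self_in_mag[of "hyper_of_real (hnorm_vec x)"] by auto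
qed

lemma appreciable_rep_mat_exists: "M \<noteq> 0 \<Longrightarrow> \<exists>N. appreciable_rep_mat M N"
  unfolding appreciable_rep_mat_def using self_in_mag[of "hyper_of_real (hnorm_mat M)"] by auto

lemma appreciable_rep_nonzero: "appreciable_rep p v \<Longrightarrow> v \<noteq> 0"
  by (auto simp: appreciable_rep_def mag_def)

text \<open>For invertible \<open>M\<close> the class \<open>hpoint (N *v v)\<close> of the image is never the unspecified one.\<close>

lemma image_nonzero:
  assumes "invertible M" "appreciable_rep_mat M N" "appreciable_rep p v"
  shows "N *v v \<noteq> 0"
proof
  assume *: "N *v v = 0"
  obtain l where l: "l \<noteq> 0" and N: "N = (\<chi> i j. inverse l * M $ i $ j)"
    using assms(2) by (auto simp: appreciable_rep_mat_def mag_def)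
  have "N *v v = inverse l *s (M *v v)"
    by (simp add: N vec_eq_iff matrix_vector_mult_def sum_distrib_left mult.assoc)
  with * l have "M *v v = 0" by (simp add: vec_eq_iff)
  moreover obtain B where "B ** M = mat 1" using assms(1) by (auto simp: invertible_def)
  ultimately have "v = 0"
    by (metis matrix_vector_mul_assoc matrix_vector_mul_lid matrix_vector_mult_0_right)
  with appreciable_rep_nonzero[OF assms(3)] show False by simp
qed

definition nonsingular :: "'a::real_normed_field hyper^3^3 \<Rightarrow> bool" where
  "nonsingular M \<longleftrightarrow> (\<exists>N. appreciable_rep_mat M N \<and> appreciable (det N))"

definition almost_equiv :: "'a::real_normed_field hproj2 \<Rightarrow> 'a hproj2 \<Rightarrow> bool" where
  "almost_equiv p q \<longleftrightarrow>
     (\<exists>v w l. appreciable_rep p v \<and> appreciable_rep q w \<and> vec_approx v (l *s w))"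

end

theory Submission
  imports Defs
begin

text \<open>
  The limited numbers form a ring in which the infinitesimals are an ideal, and this ideal is
  prime: a product of two numbers that are not infinitesimal is not infinitesimal.  Appreciable
  means limited and not infinitesimal, and a vector has appreciable norm iff its entries are
  limited and not all of them infinitesimal (\<open>appreciable_hnorm_vec_iff\<close>).  Consequently the
  appreciable representatives of a point are exactly those of its coordinate vectors that have
  appreciable norm (\<open>appreciable_rep_iff\<close>).

  Let \<open>N\<close> be an appreciable representative of the transformation with appreciable determinant,
  and let \<open>v \<simeq> l w\<close> for appreciable representatives \<open>v\<close>, \<open>w\<close> of the two points.  The entries of
  \<open>N\<close> are limited, so \<open>N v - l (N w) = N (v - l w)\<close> has infinitesimal entries.  It remains to see
  that \<open>N v\<close> and \<open>N w\<close> are themselves appreciable representatives.  Their entries are clearly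
  limited.  If all entries of \<open>N v\<close> were infinitesimal, then by Cramer's rule every product
  \<open>v\<^sub>k det N\<close> would be the determinant of a limited matrix with an infinitesimal column, hence
  infinitesimal; as \<open>det N\<close> is not infinitesimal, all \<open>v\<^sub>k\<close> would be, which is impossible
  (\<open>appreciable_hnorm_vec_image\<close>).  Any other choice of representatives changes \<open>N v\<close> and \<open>N w\<close>
  by nonzero factors only, so it yields the same two image points.
\<close>


section \<open>Limited and infinitesimal numbers\<close>

lemma habs_nonneg [simp]: "0 \<le> habs x"
  by transfer simp

lemma habs_mult: "habs (x * y) = habs x * habs y"
  by transfer (simp add: norm_mult)

lemma habs_triangle_ineq: "habs (x + y) \<le> habs x + habs y"
  by transfer (simp add: norm_triangle_ineq)

lemma habs_inverse: "habs (inverse x) = inverse (habs x)"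
  by transfer (simp add: norm_inverse)

lemma habs_0 [simp]: "habs 0 = 0"
  by simp

lemma habs_1 [simp]: "habs 1 = 1"
  by transfer simp

lemma habs_minus [simp]: "habs (- x) = habs x"
  by transfer simp

lemma habs_hyper_of_real [simp]: "habs (hyper_of_real x) = \<bar>x\<bar>"
  by transfer simp

definition limited :: "'a::real_normed_field hyper \<Rightarrow> bool" where
  "limited r \<longleftrightarrow> (\<exists>n::nat. habs r < of_nat n)"

lemma limitedI: "habs r \<le> of_nat n \<Longrightarrow> limited r"
  unfolding limited_def by (rule exI[of _ "Suc n"]) simp

lemma infinitesimalD: "infinitesimal r \<Longrightarrow> n > 0 \<Longrightarrow> habs r < 1 / of_nat n"
  by (simp add: infinitesimal_def)

lemma limited_mono: "habs x \<le> habs y \<Longrightarrow> limited y \<Longrightarrow> limited x"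
  unfolding limited_def by (meson le_less_trans)

lemma infinitesimal_mono: "habs x \<le> habs y \<Longrightarrow> infinitesimal y \<Longrightarrow> infinitesimal x"
  unfolding infinitesimal_def by (meson le_less_trans)

lemma limited_0 [simp]: "limited 0"
  by (rule limitedI[of _ 0]) simp

lemma limited_1 [simp]: "limited 1"
  by (rule limitedI[of _ 1]) simp

lemma infinitesimal_0 [simp]: "infinitesimal 0"
  by (simp add: infinitesimal_def)

lemma limited_minus [simp]: "limited (- x) \<longleftrightarrow> limited x"
  by (simp add: limited_def)

lemma limited_add: "limited x \<Longrightarrow> limited y \<Longrightarrow> limited (x + y)"
proof -
  assume "limited x" "limited y"
  then obtain m n :: nat where "habs x < of_nat m" "habs y < of_nat n"
    by (auto simp: limited_def)
  then have "habs (x + y) \<le> of_nat (m + n)"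
    using habs_triangle_ineq[of x y] by simp
  then show ?thesis by (rule limitedI)
qed

lemma limited_mult: "limited x \<Longrightarrow> limited y \<Longrightarrow> limited (x * y)"
proof -
  assume "limited x" "limited y"
  then obtain m n :: nat where "habs x < of_nat m" "habs y < of_nat n"
    by (auto simp: limited_def)
  then have "habs (x * y) \<le> of_nat (m * n)"
    by (simp add: habs_mult mult_mono)
  then show ?thesis by (rule limitedI)
qed

lemma infinitesimal_add: "infinitesimal x \<Longrightarrow> infinitesimal y \<Longrightarrow> infinitesimal (x + y)"
  unfolding infinitesimal_def[of "x + y"]
proof (intro allI impI)
  fix n :: nat
  assume xy: "infinitesimal x" "infinitesimal y" and n: "n > 0"
  have "habs x < 1 / of_nat (2 * n)" "habs y < 1 / of_nat (2 * n)"
    using infinitesimalD[OF xy(1), of "2 * n"] infinitesimalD[OF xy(2), of "2 * n"] n by auto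
  moreover have "1 / of_nat (2 * n) + 1 / of_nat (2 * n) = (1 / of_nat n :: real hyper)"
    using n by (simp add: field_simps)
  ultimately show "habs (x + y) < 1 / of_nat n"
    using habs_triangle_ineq[of x y] by linarith
qed

lemma infinitesimal_mult_limited: "infinitesimal x \<Longrightarrow> limited y \<Longrightarrow> infinitesimal (x * y)"
  unfolding infinitesimal_def[of "x * y"]
proof (intro allI impI)
  fix n :: nat
  assume xy: "infinitesimal x" "limited y" and n: "n > 0"
  obtain m :: nat where m: "habs y < of_nat m" using xy(2) by (auto simp: limited_def)
  then have m0: "m > 0" using le_less_trans[OF habs_nonneg m] by simp
  have "habs x < 1 / of_nat (n * m)" using xy(1) n m0 by (intro infinitesimalD) auto
  then have "habs x * of_nat m < 1 / of_nat (n * m) * of_nat m"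
    using m0 by (intro mult_strict_right_mono) auto
  also have "\<dots> = 1 / of_nat n" using m0 by simp
  finally have "habs x * of_nat m < 1 / of_nat n" .
  moreover have "habs x * habs y \<le> habs x * of_nat m"
    using m by (intro mult_left_mono) auto
  ultimately show "habs (x * y) < 1 / of_nat n" by (simp add: habs_mult)
qed

text \<open>
  Lower bounds \<open>1 / m\<close> and \<open>1 / n\<close> for the factors multiply to the lower bound \<open>1 / (m n)\<close> for
  the product.
\<close>

lemma infinitesimal_mult_cases: "infinitesimal (x * y) \<Longrightarrow> infinitesimal x \<or> infinitesimal y"
proof (rule ccontr)
  assume xy: "infinitesimal (x * y)" and "\<not> (infinitesimal x \<or> infinitesimal y)"
  then obtain m n :: nat where mn: "m > 0" "n > 0" "1 / of_nat m \<le> habs x" "1 / of_nat n \<le> habs y"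
    by (auto simp: infinitesimal_def not_less)
  then have "1 / of_nat m * (1 / of_nat n) \<le> habs x * habs y"
    by (intro mult_mono) auto
  moreover have "habs (x * y) < 1 / of_nat (m * n)"
    using xy mn by (intro infinitesimalD) auto
  ultimately show False by (simp add: habs_mult)
qed

lemma limited_power2D: "limited (x\<^sup>2) \<Longrightarrow> limited x"
proof -
  assume "limited (x\<^sup>2)"
  then obtain n :: nat where n: "habs x * habs x < of_nat n"
    by (auto simp: limited_def power2_eq_square habs_mult)
  have "habs x \<le> of_nat n"
  proof (rule ccontr)
    assume "\<not> habs x \<le> of_nat n"
    then have less: "of_nat n < habs x" by simp
    moreover have "n > 0" using le_less_trans[OF _ n, of 0] by simp
    ultimately have "of_nat n * 1 \<le> habs x * habs x"
      by (intro mult_mono) (auto intro: order_trans[of 1 "of_nat n"])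
    with n show False by simp
  qed
  then show ?thesis by (rule limitedI)
qed

lemma appreciable_iff: "appreciable r \<longleftrightarrow> limited r \<and> \<not> infinitesimal r"
proof
  assume "appreciable r"
  then show "limited r \<and> \<not> infinitesimal r"
    by (auto simp: appreciable_def limited_def infinitesimal_def intro: less_imp_le)
next
  assume "limited r \<and> \<not> infinitesimal r"
  then obtain m n :: nat where mn: "habs r < of_nat m" "n > 0" "1 / of_nat n \<le> habs r"
    by (auto simp: limited_def infinitesimal_def not_less)
  \<comment> \<open>The lower bound has to be strict, so the common bound must exceed \<open>n\<close>.\<close>
  define k where "k = m + n + 1"
  have "1 / of_nat k < (1 / of_nat n :: real hyper)"
    using mn(2) by (intro divide_strict_left_mono) (auto simp: k_def add_pos_nonneg)
  then have "1 / of_nat k < habs r" using mn(3) by simp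
  moreover have "habs r < of_nat k"
    using mn(1) by (rule less_le_trans) (simp add: k_def)
  ultimately show "appreciable r"
    unfolding appreciable_def by (intro exI[of _ k]) (simp add: k_def)
qed

lemma limited_sum: "(\<And>i. i \<in> A \<Longrightarrow> limited (f i)) \<Longrightarrow> limited (\<Sum>i\<in>A. f i)"
  by (induction A rule: infinite_finite_induct) (auto intro: limited_add)

lemma infinitesimal_sum:
  "(\<And>i. i \<in> A \<Longrightarrow> infinitesimal (f i)) \<Longrightarrow> infinitesimal (\<Sum>i\<in>A. f i)"
  by (induction A rule: infinite_finite_induct) (auto intro: infinitesimal_add)

lemma limited_prod: "(\<And>i. i \<in> A \<Longrightarrow> limited (f i)) \<Longrightarrow> limited (\<Prod>i\<in>A. f i)"
  by (induction A rule: infinite_finite_induct) (auto intro: limited_mult)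


section \<open>Vectors and matrices of appreciable norm\<close>

lemma hsqrt_power2: "0 \<le> x \<Longrightarrow> (hsqrt x)\<^sup>2 = x"
  unfolding power2_eq_square by transfer (auto elim: eventually_mono)

lemma hsqrt_nonneg: "0 \<le> x \<Longrightarrow> 0 \<le> hsqrt x"
  by transfer (auto elim: eventually_mono)

lemma hnorm_vec_nonneg: "0 \<le> hnorm_vec x"
  by (simp add: hnorm_vec_def hsqrt_nonneg sum_nonneg)

lemma hnorm_vec_power2: "(hnorm_vec x)\<^sup>2 = (\<Sum>i\<in>UNIV. (habs (x $ i))\<^sup>2)"
  by (simp add: hnorm_vec_def hsqrt_power2 sum_nonneg)

lemma hnorm_mat_nonneg: "0 \<le> hnorm_mat M"
  by (simp add: hnorm_mat_def hsqrt_nonneg sum_nonneg)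

lemma hnorm_mat_power2: "(hnorm_mat M)\<^sup>2 = (\<Sum>i\<in>UNIV. \<Sum>j\<in>UNIV. (habs (M $ i $ j))\<^sup>2)"
  by (simp add: hnorm_mat_def hsqrt_power2 sum_nonneg)

lemma habs_component_le_hnorm_vec: "habs (x $ i) \<le> hnorm_vec x"
proof (rule power2_le_imp_le)
  show "(habs (x $ i))\<^sup>2 \<le> (hnorm_vec x)\<^sup>2"
    unfolding hnorm_vec_power2 by (rule member_le_sum) auto
qed (rule hnorm_vec_nonneg)

lemma habs_entry_le_hnorm_mat: "habs (M $ i $ j) \<le> hnorm_mat M"
proof (rule power2_le_imp_le)
  have "(habs (M $ i $ j))\<^sup>2 \<le> (\<Sum>j\<in>UNIV. (habs (M $ i $ j))\<^sup>2)"
    by (rule member_le_sum) auto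
  also have "\<dots> \<le> (hnorm_mat M)\<^sup>2"
    unfolding hnorm_mat_power2 by (rule member_le_sum) (auto intro: sum_nonneg)
  finally show "(habs (M $ i $ j))\<^sup>2 \<le> (hnorm_mat M)\<^sup>2" .
qed (rule hnorm_mat_nonneg)

lemma hnorm_vec_scale: "hnorm_vec (c *s x) = habs c * hnorm_vec x"
proof (rule power2_eq_imp_eq)
  show "(hnorm_vec (c *s x))\<^sup>2 = (habs c * hnorm_vec x)\<^sup>2"
    by (simp add: hnorm_vec_power2 habs_mult power_mult_distrib sum_distrib_left)
qed (simp_all add: hnorm_vec_nonneg)

lemma hnorm_mat_scale: "hnorm_mat (\<chi> i j. c * M $ i $ j) = habs c * hnorm_mat M"
proof (rule power2_eq_imp_eq)
  show "(hnorm_mat (\<chi> i j. c * M $ i $ j))\<^sup>2 = (habs c * hnorm_mat M)\<^sup>2"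
    by (simp add: hnorm_mat_power2 habs_mult power_mult_distrib sum_distrib_left)
qed (simp_all add: hnorm_mat_nonneg)

text \<open>
  The norm dominates every entry, and conversely its square is the sum of the squares of the
  entries; limited and infinitesimal numbers are detected by their squares.
\<close>

lemma appreciable_hnorm_vec_iff:
  "appreciable (hnorm_vec x) \<longleftrightarrow> (\<forall>i. limited (x $ i)) \<and> (\<exists>i. \<not> infinitesimal (x $ i))"
proof -
  have le: "habs (x $ i) \<le> habs (hnorm_vec x)" for i
    using habs_component_le_hnorm_vec[of x i] hnorm_vec_nonneg[of x] by simp
  have "limited (hnorm_vec x)" if "\<forall>i. limited (x $ i)"
  proof (rule limited_power2D)
    have "limited (habs (x $ i))" for i
      by (rule limited_mono[of _ "x $ i"]) (use that in auto)
    then show "limited ((hnorm_vec x)\<^sup>2)"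
      unfolding hnorm_vec_power2 unfolding power2_eq_square by (intro limited_sum limited_mult)
  qed
  moreover have "infinitesimal (hnorm_vec x)" if "\<forall>i. infinitesimal (x $ i)"
  proof -
    have "infinitesimal (habs (x $ i) * habs (x $ i))" for i
    proof (rule infinitesimal_mult_limited)
      show inf: "infinitesimal (habs (x $ i))"
        by (rule infinitesimal_mono[of _ "x $ i"]) (use that in auto)
      show "limited (habs (x $ i))"
        by (rule limitedI[of _ 1]) (use infinitesimalD[OF inf, of 1] in auto)
    qed
    then have "infinitesimal ((hnorm_vec x)\<^sup>2)"
      unfolding hnorm_vec_power2 unfolding power2_eq_square by (intro infinitesimal_sum)
    then show ?thesis
      unfolding power2_eq_square using infinitesimal_mult_cases by blast
  qed
  ultimately show ?thesis
    unfolding appreciable_iff using limited_mono[OF le] infinitesimal_mono[OF le] by blast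
qed

lemma limited_matrix_vector_mult:
  assumes "\<And>i j. limited (N $ i $ j)" "\<And>j. limited (v $ j)"
  shows "limited ((N *v v) $ i)"
  unfolding matrix_vector_mult_def using assms by (auto intro!: limited_sum limited_mult)

lemma infinitesimal_matrix_vector_mult:
  assumes "\<And>i j. limited (N $ i $ j)" "\<And>j. infinitesimal (v $ j)"
  shows "infinitesimal ((N *v v) $ i)"
  unfolding matrix_vector_mult_def
  using infinitesimal_mult_limited[OF assms(2) assms(1)]
  by (auto intro!: infinitesimal_sum simp: mult.commute)

text \<open>Every term of the Leibniz expansion contains a factor from the infinitesimal column.\<close>

lemma infinitesimal_det_column:
  fixes A :: "'a::real_normed_field hyper^'n^'n"
  assumes lim: "\<And>i j. j \<noteq> k \<Longrightarrow> limited (A $ i $ j)" and inf: "\<And>i. infinitesimal (A $ i $ k)"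
  shows "infinitesimal (det A)"
  unfolding det_def
proof (rule infinitesimal_sum)
  fix p assume "p \<in> {p. p permutes (UNIV :: 'n set)}"
  then have p: "p permutes UNIV" by simp
  define i where "i = inv p k"
  have pi: "p i = k" unfolding i_def using p by (simp add: permutes_inverses(1))
  have "(\<Prod>i\<in>UNIV. A $ i $ p i) = A $ i $ k * (\<Prod>j\<in>UNIV - {i}. A $ j $ p j)"
    using prod.remove[of UNIV i "\<lambda>i. A $ i $ p i"] pi by simp
  moreover have "limited (\<Prod>j\<in>UNIV - {i}. A $ j $ p j)"
    using pi permutes_inj[OF p] by (intro limited_prod lim) (auto dest: injD)
  ultimately have "infinitesimal (\<Prod>i\<in>UNIV. A $ i $ p i)"
    using infinitesimal_mult_limited[OF inf] by simp
  moreover have "limited (of_int (sign p) :: 'a hyper)"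
    by (simp add: sign_def)
  ultimately show "infinitesimal (of_int (sign p) * (\<Prod>i\<in>UNIV. A $ i $ p i))"
    by (subst mult.commute) (rule infinitesimal_mult_limited)
qed

text \<open>
  By Cramer's rule \<open>v\<^sub>k det N\<close> is the determinant of \<open>N\<close> with column \<open>k\<close> replaced by \<open>N v\<close>, so a
  limited matrix whose determinant is not infinitesimal cannot shrink \<open>v\<close> to an infinitesimal
  vector.  This replaces a bound on the entries of the inverse matrix.
\<close>

lemma appreciable_hnorm_vec_image:
  fixes N :: "'a::real_normed_field hyper^'n^'n"
  assumes N: "\<And>i j. limited (N $ i $ j)" and det: "\<not> infinitesimal (det N)"
    and v: "appreciable (hnorm_vec v)"
  shows "appreciable (hnorm_vec (N *v v))"
  unfolding appreciable_hnorm_vec_iff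
proof (intro conjI allI)
  show "limited ((N *v v) $ i)" for i
    using v N by (auto simp: appreciable_hnorm_vec_iff intro: limited_matrix_vector_mult)
  show "\<exists>i. \<not> infinitesimal ((N *v v) $ i)"
  proof (rule ccontr)
    assume "\<nexists>i. \<not> infinitesimal ((N *v v) $ i)"
    then have "infinitesimal (det (\<chi> i j. if j = k then (N *v v) $ i else N $ i $ j))" for k
      using N by (intro infinitesimal_det_column[of k]) auto
    then have "infinitesimal (v $ k * det N)" for k
      by (simp add: cramer_lemma)
    then have "infinitesimal (v $ k)" for k
      using det infinitesimal_mult_cases by blast
    with v show False by (auto simp: appreciable_hnorm_vec_iff)
  qed
qed


section \<open>Appreciable representatives and the image points\<close>

lemma appreciable_cong_habs: "habs x = habs y \<Longrightarrow> appreciable x \<longleftrightarrow> appreciable y"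
  by (simp add: appreciable_def)

text \<open>
  Dividing by a scale of the magnitude of a norm leaves a vector or matrix whose norm is the
  absolute value of the appreciable factor in the definition of \<open>mag\<close>.
\<close>

lemma appreciable_norm_divide:
  fixes l :: "'a::real_normed_field hyper"
  assumes "l \<in> mag (hyper_of_real r)" "0 \<le> r"
  shows "appreciable (habs (inverse l) * r)"
proof -
  from assms(1) obtain A where l: "l \<noteq> 0" and A: "appreciable A" "hyper_of_real r = A * l"
    by (auto simp: mag_def)
  have "r = habs (A * l)"
    using A(2)[symmetric] assms(2) by simp
  then have "habs (inverse l) * r = habs A"
    using l by (simp add: habs_mult habs_inverse)
  moreover have "appreciable (habs A) \<longleftrightarrow> appreciable A"
    by (rule appreciable_cong_habs) simp
  ultimately show ?thesis using A(1) by simp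
qed

lemma appreciable_rep_iff:
  "appreciable_rep p v \<longleftrightarrow> p = hpoint v \<and> appreciable (hnorm_vec v)"
proof (intro iffI conjI)
  assume rep: "appreciable_rep p v"
  then obtain x l where x: "x \<noteq> 0" "p = hpoint x" and l: "l \<in> mag (hyper_of_real (hnorm_vec x))"
    and v: "v = inverse l *s x"
    by (auto simp: appreciable_rep_def)
  have l0: "l \<noteq> 0" using l by (simp add: mag_def)
  have "x = l *s v" unfolding v using l0 by (simp add: vector_smult_assoc)
  then show "p = hpoint v"
    using x appreciable_rep_nonzero[OF rep] l0 hpoint_eq_iff[of x v] by auto
  show "appreciable (hnorm_vec v)"
    unfolding v hnorm_vec_scale using l by (rule appreciable_norm_divide) (rule hnorm_vec_nonneg)
next
  assume v: "p = hpoint v \<and> appreciable (hnorm_vec v)"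
  have "v \<noteq> 0"
    using v by (auto simp: appreciable_hnorm_vec_iff)
  moreover have "appreciable (hyper_of_real (hnorm_vec v) :: 'a hyper)"
    using v appreciable_cong_habs[of "hyper_of_real (hnorm_vec v) :: 'a hyper" "hnorm_vec v"]
    by simp
  ultimately show "appreciable_rep p v"
    unfolding appreciable_rep_def using v
    by (intro exI[of _ v] exI[of _ 1]) (auto simp: mag_def)
qed

lemma limited_appreciable_rep_mat:
  assumes "appreciable_rep_mat M N"
  shows "limited (N $ i $ j)"
proof -
  from assms obtain l where l: "l \<in> mag (hyper_of_real (hnorm_mat M))"
    and N: "N = (\<chi> i j. inverse l * M $ i $ j)"
    by (auto simp: appreciable_rep_mat_def)
  have "appreciable (hnorm_mat N)"
    unfolding N hnorm_mat_scale using l by (rule appreciable_norm_divide) (rule hnorm_mat_nonneg)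
  then have "limited (hnorm_mat N)" by (simp add: appreciable_iff)
  moreover have "habs (N $ i $ j) \<le> habs (hnorm_mat N)"
    using habs_entry_le_hnorm_mat[of N] hnorm_mat_nonneg[of N] by simp
  ultimately show ?thesis by (rule limited_mono[rotated])
qed

lemma appreciable_rep_mat_scale:
  assumes "appreciable_rep_mat M N" "appreciable_rep_mat M N'"
  obtains c where "c \<noteq> 0" "\<And>v. N' *v v = c *s (N *v v)"
proof -
  from assms obtain l l' where l: "l \<noteq> 0" "l' \<noteq> 0"
    and N: "N = (\<chi> i j. inverse l * M $ i $ j)" "N' = (\<chi> i j. inverse l' * M $ i $ j)"
    by (auto simp: appreciable_rep_mat_def mag_def)
  have "N' *v v = (l / l') *s (N *v v)" for v
    using l by (simp add: N vec_eq_iff matrix_vector_mult_def sum_distrib_left field_simps)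
  with l show thesis by (intro that[of "l / l'"]) auto
qed

lemma appreciable_rep_scale:
  assumes "appreciable_rep p v" "appreciable_rep p v'"
  obtains c where "c \<noteq> 0" "v' = c *s v"
  using assms hpoint_eq_iff[of v' v] appreciable_rep_nonzero
  unfolding appreciable_rep_iff by metis

text \<open>Changing representatives multiplies the image vector by a nonzero scalar.\<close>

lemma hpoint_image_unique:
  assumes M: "invertible M" "appreciable_rep_mat M N" "appreciable_rep_mat M N'"
    and v: "appreciable_rep p v" "appreciable_rep p v'"
  shows "hpoint (N' *v v') = hpoint (N *v v)"
proof -
  obtain c where c: "c \<noteq> 0" "\<And>v. N' *v v = c *s (N *v v)"
    using appreciable_rep_mat_scale[OF M(2,3)] by blast
  obtain d where d: "d \<noteq> 0" "v' = d *s v"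
    using appreciable_rep_scale[OF v] by blast
  have "N' *v v' = (c * d) *s (N *v v)"
    unfolding c(2) d(2) by (simp add: vector_scalar_commute vector_smult_assoc)
  then show ?thesis
    using c(1) d(1) hpoint_eq_iff[OF image_nonzero[OF M(1,3) v(2)] image_nonzero[OF M(1,2) v(1)]]
    by auto
qed

text \<open>
  Almost equivalence only asks for some pair of representatives, and \<open>N v\<close>, \<open>N w\<close> with the factor
  \<open>l\<close> of \<open>v \<simeq> l w\<close> provide one, for the \<open>N\<close> that witnesses nonsingularity.
\<close>

lemma almost_equiv_image:
  fixes M :: "'a::real_normed_field hyper^3^3"
  assumes M: "invertible M" "nonsingular M" and pq: "almost_equiv p q"
    and reps: "appreciable_rep_mat M N'" "appreciable_rep p v'" "appreciable_rep q w'"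
  shows "almost_equiv (hpoint (N' *v v')) (hpoint (N' *v w'))"
proof -
  obtain N where N: "appreciable_rep_mat M N" "appreciable (det N)"
    using M(2) by (auto simp: nonsingular_def)
  obtain v w l where vw: "appreciable_rep p v" "appreciable_rep q w" "vec_approx v (l *s w)"
    using pq by (auto simp: almost_equiv_def)
  have lim: "limited (N $ i $ j)" for i j
    by (rule limited_appreciable_rep_mat[OF N(1)])
  have image: "appreciable_rep (hpoint (N *v u)) (N *v u)" if "appreciable_rep r u" for r u
    using appreciable_hnorm_vec_image[OF lim] that N(2)
    by (simp add: appreciable_rep_iff appreciable_iff)
  have "N *v v - l *s (N *v w) = N *v (v - l *s w)"
    by (simp add: matrix_vector_mult_diff_distrib vector_scalar_commute)
  moreover have "infinitesimal ((N *v (v - l *s w)) $ i)" for i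
    using vw(3) lim by (intro infinitesimal_matrix_vector_mult) (auto simp: vec_approx_def)
  ultimately have "vec_approx (N *v v) (l *s (N *v w))"
    unfolding vec_approx_def by (metis vector_minus_component)
  then have "almost_equiv (hpoint (N *v v)) (hpoint (N *v w))"
    unfolding almost_equiv_def using image[OF vw(1)] image[OF vw(2)] by blast
  then show ?thesis
    using hpoint_image_unique[OF M(1) N(1) reps(1)] vw(1,2) reps(2,3) by metis
qed

theorem theorem4p15:
  shows
    "(\<forall>(M :: real hyper^3^3) (p :: real hproj2) (p' :: real hproj2).
        invertible M \<and> nonsingular M \<and> almost_equiv p p' \<longrightarrow>
        (\<forall>M\<^sub>A p\<^sub>A p'\<^sub>A.
           appreciable_rep_mat M M\<^sub>A \<and> appreciable_rep p p\<^sub>A \<and> appreciable_rep p' p'\<^sub>A \<longrightarrow>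
           almost_equiv (hpoint (M\<^sub>A *v p\<^sub>A)) (hpoint (M\<^sub>A *v p'\<^sub>A)))) \<and>
     (\<forall>(M :: complex hyper^3^3) (p :: complex hproj2) (p' :: complex hproj2).
        invertible M \<and> nonsingular M \<and> almost_equiv p p' \<longrightarrow>
        (\<forall>M\<^sub>A p\<^sub>A p'\<^sub>A.
           appreciable_rep_mat M M\<^sub>A \<and> appreciable_rep p p\<^sub>A \<and> appreciable_rep p' p'\<^sub>A \<longrightarrow>
           almost_equiv (hpoint (M\<^sub>A *v p\<^sub>A)) (hpoint (M\<^sub>A *v p'\<^sub>A))))"
  by (auto intro: almost_equiv_image)

end
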